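(* Let $n\ge 1$ be an integer and $T>0$ a real number. Let $\beta_1$ be the second largest eigenvalue of the transition matrix $P$ of the Gibbs sampler for the one-dimensional Ising model with three states on $n$ sites at temperature $T$. Then $$\beta_1 < 1-\frac{3}{n^{2}}\cdot\frac{e^{-4/T}}{1+2e^{-4/T}}.$$
   Context: Let $c^{(1)},c^{(2)},c^{(3)}$ be three distinct states (colors) and let $\chi=\{c^{(1)},c^{(2)},c^{(3)}\}^n$. The one-dimensional Ising model with three states on $n$ sites at temperature $T>0$ is the probability measure on $\chi$ given by $$\pi(x)=\frac{1}{Z_T}\exp\Big\{\frac1T\sum_{k=1}^{n-1}\big(\mathbf 1_{\{x_k=x_{k+1}\}}-\mathbf 1_{\{x_k\ne x_{k+1}\}}\big)\Big\},\qquad x=(x_1,\dots,x_n)\in\chi,$$ where $Z_T=\sum_{x\in\chi}\exp\{\frac1T\sum_{k=1}^{n-1}(\mathbf 1_{\{x_k=x_{k+1}\}}-\mathbf 1_{\{x_k\ne x_{k+1}\}})\}$ is the normalizing constant (an empty sum is $0$). For $x\in\chi$, a site $i\in\{1,\dots,n\}$ and a color $y_i$, set $$\pi(y_i\mid x)=\frac{\pi(x_1,\dots,x_{i-1},y_i,x_{i+1},\dots,x_n)}{\sum_{l=1}^{3}\pi(x_1,\dots,x_{i-1},c^{(l)},x_{i+1},\dots,x_n)}.$$ The Gibbs sampler chooses a coordinate uniformly at random and updates it according to its conditional probability given the other coordinates. Its transition matrix $P$ on $\chi$ is: $P(x,y)=\frac1n\,\pi(y_i\mid x)$ if $x_i\neq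 y_i$ and $x_j=y_j$ for all $j\ne i$ (for some site $i$); $P(x,x)=1-\frac1n\sum_{i=1}^n\sum_{y_i\neq x_i}\pi(y_i\mid x)$, where the inner sum is over colors $y_i$ different from $x_i$; and $P(x,y)=0$ otherwise. The matrix $P$ is irreducible and reversible with respect to $\pi$, so its eigenvalues are real. Counted with multiplicity they are written $1=\beta_0>\beta_1\ge\beta_2\ge\cdots\ge\beta_{|\chi|-1}>-1$. *)

theory Defs
  imports "Jordan_Normal_Form.Char_Poly" "HOL-Library.Multiset"
begin

text \<open>
  A configuration on \<open>n\<close> sites is a list \<open>x\<close> of length \<open>n\<close> over the colors; the usual
  \<open>x\<^sub>k\<close> for \<open>1 \<le> k \<le> n\<close> is \<open>x ! (k - 1)\<close>. The colors are passed as a list \<open>C\<close>, whose order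
  only serves to number the rows and columns of the transition matrix.
\<close>

definition configs :: "'c list \<Rightarrow> nat \<Rightarrow> 'c list set" where
  "configs C n = {x. length x = n \<and> set x \<subseteq> set C}"

definition ising_weight :: "nat \<Rightarrow> real \<Rightarrow> 'c list \<Rightarrow> real" where
  "ising_weight n T x =
     exp (1 / T * (\<Sum>k<n - 1. of_bool (x ! k = x ! Suc k) - of_bool (x ! k \<noteq> x ! Suc k)))"

definition ising_Z :: "'c list \<Rightarrow> nat \<Rightarrow> real \<Rightarrow> real" where
  "ising_Z C n T = (\<Sum>x\<in>configs C n. ising_weight n T x)"

definition ising :: "'c list \<Rightarrow> nat \<Rightarrow> real \<Rightarrow> 'c list \<Rightarrow> real" where
  "ising C n T x = 1 / ising_Z C n T * ising_weight n T x"

definition ising_cond :: "'c list \<Rightarrow> nat \<Rightarrow> real \<Rightarrow> nat \<Rightarrow> 'c \<Rightarrow> 'c list \<Rightarrow> real" where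
  "ising_cond C n T i c x =
     ising C n T (x[i := c]) / (\<Sum>l\<in>set C. ising C n T (x[i := l]))"

definition differ_only_at :: "nat \<Rightarrow> 'c list \<Rightarrow> 'c list \<Rightarrow> nat \<Rightarrow> bool" where
  "differ_only_at n x y i \<longleftrightarrow>
     i < n \<and> x ! i \<noteq> y ! i \<and> (\<forall>j<n. j \<noteq> i \<longrightarrow> x ! j = y ! j)"

definition gibbs_kernel :: "'c list \<Rightarrow> nat \<Rightarrow> real \<Rightarrow> 'c list \<Rightarrow> 'c list \<Rightarrow> real" where
  "gibbs_kernel C n T x y =
     (if x = y then
        1 - 1 / real n * (\<Sum>i<n. \<Sum>c\<in>set C - {x ! i}. ising_cond C n T i c x)
      else if \<exists>i. differ_only_at n x y i then
        (let i = (THE i. differ_only_at n x y i) in 1 / real n * ising_cond C n T i (y ! i) x)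
      else 0)"

definition config_list :: "'c list \<Rightarrow> nat \<Rightarrow> 'c list list" where
  "config_list C n = List.n_lists n C"

lemma set_config_list: "set (config_list C n) = configs C n"
  by (simp add: config_list_def configs_def set_n_lists)

lemma distinct_config_list: "distinct C \<Longrightarrow> distinct (config_list C n)"
  by (simp add: config_list_def distinct_n_lists)

lemma length_config_list: "length (config_list C n) = length C ^ n"
  by (simp add: config_list_def length_n_lists)

definition gibbs_matrix :: "'c list \<Rightarrow> nat \<Rightarrow> real \<Rightarrow> real mat" where
  "gibbs_matrix C n T =
     (let xs = config_list C n in
      mat (length xs) (length xs) (\<lambda>(a, b). gibbs_kernel C n T (xs ! a) (xs ! b)))"

text \<open>
  The real eigenvalues of a matrix, repeated according to algebraic multiplicity, in decreasing
  order. For a matrix that is reversible with respect to a positive measure, such as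
  \<^const>\<open>gibbs_matrix\<close>, all complex eigenvalues are real and algebraic and geometric
  multiplicities agree, so these are all the eigenvalues.
\<close>

definition eigenvalues_desc :: "real mat \<Rightarrow> real list" where
  "eigenvalues_desc A = rev (sorted_list_of_multiset (proots (char_poly A)))"

definition gibbs_beta :: "'c list \<Rightarrow> nat \<Rightarrow> real \<Rightarrow> nat \<Rightarrow> real" where
  "gibbs_beta C n T j = eigenvalues_desc (gibbs_matrix C n T) ! j"

end

theory Submission
  imports Defs "Jordan_Normal_Form.Schur_Decomposition" "HOL-Analysis.Convex"
begin

text \<open>
  The bound is a Poincare inequality proved with canonical paths. Write \<open>r = exp (- 2 / T)\<close> and let
  \<open>q\<close> be the number of colors. Up to a constant factor the Ising weight of a configuration is
  \<open>r\<close> to the number of neighbouring pairs of different colors, so \<open>\<pi>\<close> is the law of a symmetric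
  Markov chain run along the sites.

  To get from \<open>x\<close> to \<open>y\<close>, replace the coordinates of \<open>x\<close> by those of \<open>y\<close> one at a time, from left to
  right. A step of such a path that recolors site \<open>k\<close> happens inside a configuration that shows \<open>y\<close> to
  the left of \<open>k\<close> and \<open>x\<close> to the right of it. The other halves of \<open>x\<close> and \<open>y\<close> are free, and
  summing over them costs nothing but a power of \<open>1 + (q - 1) r\<close>, because a sum of chain weights
  with one end fixed does not depend on the color at that end. Hence the load that all paths put on
  one edge of the sampler is given by a single local ratio of bond weights at site \<open>k\<close>, which is at
  most \<open>(1 + (q - 1) r\<^sup>2) / r\<^sup>2\<close> in general (\<open>fibre_sum_bound\<close>, \<open>edge_bound\<close>) and at most the
  smaller \<open>(1 + (q - 1) r) / r\<close> at the leftmost site, which has no left neighbour.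

  The increment \<open>f y - f x\<close> is the sum of the increments of \<open>f\<close> along the path. Applying the
  Cauchy-Schwarz inequality with the local ratios themselves as weights bounds the variance of \<open>f\<close> by
  its Dirichlet form times \<open>n / q\<close> times the sum of the local ratios (\<open>poincare\<close>, \<open>dirichlet_form\<close>).
  This sum is strictly smaller than \<open>n\<close> times the general ratio, because the first term is; that
  gives the strict inequality of the theorem.

  The passage from quadratic forms to the second entry of the sorted list of eigenvalues is
  the variational principle \<open>second_eigenvalue_le\<close>. It comes with the fact that the characteristic
  polynomial of a reversible matrix splits over the reals, without which the list might be too short
  to have a second entry.
\<close>

section \<open>Eigenvalues of reversible matrices\<close>

text \<open>
  Reversibility says that \<open>A\<close> is self-adjoint for the inner product weighted by \<open>m\<close>. Pairing an
  eigenvector with its image therefore gives a real number, which is the eigenvalue times the positive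
  squared norm of the eigenvector.
\<close>

lemma reversible_eigenvalue_real:
  fixes A :: "real mat" and m :: "nat \<Rightarrow> real" and z :: complex
  assumes A: "A \<in> carrier_mat n n"
    and m: "\<And>i. i < n \<Longrightarrow> m i > 0"
    and rev: "\<And>i j. i < n \<Longrightarrow> j < n \<Longrightarrow> m i * A $$ (i, j) = m j * A $$ (j, i)"
    and z: "eigenvalue (map_mat complex_of_real A) z"
  shows "z \<in> \<real>"
proof -
  obtain v where v: "v \<in> carrier_vec n" "v \<noteq> 0\<^sub>v n"
    and Av: "map_mat complex_of_real A *\<^sub>v v = z \<cdot>\<^sub>v v"
    using z A by (auto simp: eigenvalue_def eigenvector_def)
  have row: "(\<Sum>j<n. of_real (A $$ (i, j)) * v $ j) = z * v $ i" if "i < n" for i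
  proof -
    have "(map_mat complex_of_real A *\<^sub>v v) $ i = (z \<cdot>\<^sub>v v) $ i" using Av by simp
    thus ?thesis using that A v by (simp add: scalar_prod_def lessThan_atLeast0)
  qed
  define N where "N = (\<Sum>i<n. m i * (cmod (v $ i))\<^sup>2)"
  define H where "H = (\<Sum>i<n. \<Sum>j<n. complex_of_real (m i * A $$ (i, j)) * (cnj (v $ i) * v $ j))"
  have "cnj H = (\<Sum>i<n. \<Sum>j<n. complex_of_real (m j * A $$ (j, i)) * (cnj (v $ j) * v $ i))"
    unfolding H_def using rev by (auto intro!: sum.cong simp: mult.commute simp flip: of_real_mult)
  also have "\<dots> = H" unfolding H_def by (rule sum.swap)
  finally have H_real: "H \<in> \<real>" by (metis Reals_cnj_iff)
  have "H = (\<Sum>i<n. of_real (m i) * cnj (v $ i) * (\<Sum>j<n. of_real (A $$ (i, j)) * v $ j))"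
    unfolding H_def by (auto intro!: sum.cong simp: sum_distrib_left algebra_simps)
  also have "\<dots> = (\<Sum>i<n. of_real (m i) * cnj (v $ i) * (z * v $ i))"
    by (auto intro!: sum.cong simp: row)
  also have "\<dots> = z * of_real N"
    unfolding N_def of_real_sum sum_distrib_left
    by (rule sum.cong) (simp_all add: complex_norm_square mult_ac del: of_real_power)
  finally have H: "H = z * of_real N" .
  obtain k where k: "k < n" "v $ k \<noteq> 0" using v by (metis eq_vecI carrier_vecD index_zero_vec)
  have "N > 0" unfolding N_def
    by (rule sum_pos2[of _ k]) (use k m in \<open>auto simp: less_imp_le\<close>)
  hence "z = H / of_real N" using H by simp
  thus ?thesis using H_real by simp
qed

lemma of_real_map_poly_eq:
  fixes p q :: "real poly"
  assumes "map_poly complex_of_real p = map_poly complex_of_real q"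
  shows "p = q"
proof (rule poly_eqI)
  fix k
  have "coeff (map_poly complex_of_real p) k = coeff (map_poly complex_of_real q) k"
    using assms by simp
  thus "coeff p k = coeff q k" by (simp add: coeff_map_poly)
qed

text \<open>
  Over the complex numbers the characteristic polynomial splits, and all its roots are real by
  \<open>reversible_eigenvalue_real\<close>, so it already splits over the reals and no root is lost in passing to the list of
  real eigenvalues.
\<close>

lemma char_poly_eigenvalues_desc:
  fixes A :: "real mat" and m :: "nat \<Rightarrow> real"
  assumes A: "A \<in> carrier_mat n n"
    and m: "\<And>i. i < n \<Longrightarrow> m i > 0"
    and rev: "\<And>i j. i < n \<Longrightarrow> j < n \<Longrightarrow> m i * A $$ (i, j) = m j * A $$ (j, i)"
  shows "char_poly A = (\<Prod>a\<leftarrow>eigenvalues_desc A. [:- a, 1:])"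
    and "length (eigenvalues_desc A) = n"
proof -
  let ?c = "map_mat complex_of_real A"
  have Ac: "?c \<in> carrier_mat n n" using A by simp
  obtain as where as: "char_poly ?c = (\<Prod>a\<leftarrow>as. [:- a, 1:])" "length as = n"
    using char_poly_factorized[OF Ac] by blast
  have real: "a \<in> \<real>" if "a \<in> set as" for a
  proof (rule reversible_eigenvalue_real[OF A m rev])
    have "poly (char_poly ?c) a = 0" using that as(1) by (simp add: linear_poly_root)
    thus "eigenvalue ?c a" by (simp add: eigenvalue_root_char_poly[OF Ac])
  qed
  define bs where "bs = map Re as"
  have as_bs: "as = map complex_of_real bs"
    unfolding bs_def using real by (auto intro!: nth_equalityI simp: complex_is_Real_iff complex_eq_iff)
  have "map_poly complex_of_real (\<Prod>a\<leftarrow>bs. [:- a, 1:]) = (\<Prod>a\<leftarrow>as. [:- a, 1:])"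
  proof -
    interpret cp: map_poly_comm_ring_hom complex_of_real ..
    show ?thesis unfolding as_bs
      by (induction bs) (simp_all add: cp.hom_mult del: mult_pCons_left)
  qed
  hence "map_poly complex_of_real (char_poly A) = map_poly complex_of_real (\<Prod>a\<leftarrow>bs. [:- a, 1:])"
    using as(1) unfolding of_real_hom.char_poly_hom[OF A] by simp
  hence cp: "char_poly A = (\<Prod>a\<leftarrow>bs. [:- a, 1:])"
    by (rule of_real_map_poly_eq)
  have "(\<Prod>a\<leftarrow>cs. [:- a, 1:]) \<noteq> 0" for cs :: "real list"
    by (induction cs) (simp_all del: mult_pCons_left)
  hence "proots (\<Prod>a\<leftarrow>bs. [:- a, 1:]) = mset bs"
    by (induction bs) (simp_all add: proots_mult del: mult_pCons_left)
  hence ed: "mset (eigenvalues_desc A) = mset bs" by (simp add: eigenvalues_desc_def cp)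
  show "char_poly A = (\<Prod>a\<leftarrow>eigenvalues_desc A. [:- a, 1:])"
    unfolding cp by (metis (no_types, lifting) ed mset_map prod_mset_prod_list)
  show "length (eigenvalues_desc A) = n"
    using mset_eq_length[OF ed] as(2) by (simp add: bs_def)
qed

text \<open>
  One half of the Courant-Fischer principle. If the quadratic form of \<open>A\<close> is at most \<open>c\<close> on a
  hyperplane, then it is at most \<open>c\<close> somewhere on the span of eigenvectors for the two largest
  eigenvalues, where it is at least the second one. The two eigenvectors come from a triangularization of
  \<open>A\<close> whose diagonal lists the eigenvalues in decreasing order: its first column is an eigenvector
  \<open>v\<close>, and the component of the second column orthogonal to \<open>v\<close> is one too, because a
  self-adjoint operator preserves the orthogonal complement of an eigenvector. Repeated eigenvalues
  need no separate treatment.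
\<close>

lemma second_eigenvalue_le:
  fixes A :: "real mat" and m u :: "nat \<Rightarrow> real"
  assumes A: "A \<in> carrier_mat n n" and n: "n \<ge> 2"
    and m: "\<And>i. i < n \<Longrightarrow> m i > 0"
    and rev: "\<And>i j. i < n \<Longrightarrow> j < n \<Longrightarrow> m i * A $$ (i, j) = m j * A $$ (j, i)"
    and quad: "\<And>f. (\<Sum>i<n. u i * f i) = 0 \<Longrightarrow>
      (\<Sum>i<n. m i * f i * (\<Sum>j<n. A $$ (i, j) * f j)) \<le> c * (\<Sum>i<n. m i * (f i)\<^sup>2)"
  shows "eigenvalues_desc A ! 1 \<le> c"
proof -
  define es where "es = eigenvalues_desc A"
  note split = char_poly_eigenvalues_desc[OF A m rev, folded es_def]
  obtain B P Q where schur: "schur_decomposition A es = (B, P, Q)" by (metis prod_cases3)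
  have sim: "similar_mat_wit A B P Q" and tri: "upper_triangular B" and dg: "diag_mat B = es"
    using schur_decomposition[OF A split(1) schur] by auto
  note carr = similar_mat_witD2[OF A sim]
  have AP: "A * P = P * B"
  proof -
    have "A * P = P * B * (Q * P)" using carr by (simp add: assoc_mult_mat[of _ n n _ n _ n])
    thus ?thesis using carr by simp
  qed
  have lt: "0 < n" "1 < n" using n by auto
  have Bdiag: "B $$ (k, k) = es ! k" if "k < n" for k
    using that dg carr by (auto simp: diag_mat_def)
  have B10: "B $$ (k, 0) = 0" if "0 < k" "k < n" for k
    using tri that carr unfolding upper_triangular_def by auto
  have B1: "B $$ (k, 1) = 0" if "1 < k" "k < n" for k
    using tri that carr unfolding upper_triangular_def by auto
  define L where "L f i = (\<Sum>j<n. A $$ (i, j) * f j)" for f i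
  define v where "v i = P $$ (i, 0)" for i
  define w where "w i = P $$ (i, 1)" for i
  define b where "b = B $$ (0, 1)"
  have PB: "L (\<lambda>i. P $$ (i, k)) i = (\<Sum>j<n. P $$ (i, j) * B $$ (j, k))" if "i < n" "k < n" for i k
  proof -
    have "(A * P) $$ (i, k) = (P * B) $$ (i, k)" using AP by simp
    thus ?thesis using that carr A unfolding L_def
      by (simp add: scalar_prod_def lessThan_atLeast0)
  qed
  have Lv: "L v i = es ! 0 * v i" if "i < n" for i
  proof -
    have "(\<Sum>j<n. P $$ (i, j) * B $$ (j, 0)) = (\<Sum>j\<in>{0}. P $$ (i, j) * B $$ (j, 0))"
      using lt B10 by (intro sum.mono_neutral_right) auto
    thus ?thesis using PB[OF that lt(1)] Bdiag[OF lt(1)] by (simp add: v_def[abs_def])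
  qed
  have Lw: "L w i = b * v i + es ! 1 * w i" if "i < n" for i
  proof -
    have "(\<Sum>j<n. P $$ (i, j) * B $$ (j, 1)) = (\<Sum>j\<in>{0, 1}. P $$ (i, j) * B $$ (j, 1))"
      using lt B1 by (intro sum.mono_neutral_right) auto
    thus ?thesis using PB[OF that lt(2)] Bdiag[OF lt(2)] by (simp add: w_def[abs_def] v_def b_def)
  qed
  have QP: "(\<Sum>j<n. Q $$ (i, j) * P $$ (j, k)) = (if i = k then 1 else 0)" if "i < n" "k < n" for i k
  proof -
    have "(\<Sum>j<n. Q $$ (i, j) * P $$ (j, k)) = (Q * P) $$ (i, k)"
      using that carr(6,7) by (simp add: scalar_prod_def lessThan_atLeast0)
    thus ?thesis using that carr(2) by simp
  qed
  have indep: "\<exists>i<n. s * v i + t * w i \<noteq> 0" if "s \<noteq> 0 \<or> t \<noteq> 0" for s t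
  proof (rule ccontr)
    assume "\<not> ?thesis"
    hence z: "s * v i + t * w i = 0" if "i < n" for i using that by auto
    have "s = (\<Sum>i<n. Q $$ (0, i) * (s * v i + t * w i))"
      using QP[OF lt(1) lt(1)] QP[OF lt(1) lt(2)]
      by (simp add: distrib_left sum.distrib v_def w_def mult.left_commute flip: sum_distrib_left)
    moreover have "t = (\<Sum>i<n. Q $$ (1, i) * (s * v i + t * w i))"
      using QP[OF lt(2) lt(1)] QP[OF lt(2) lt(2)]
      by (simp add: distrib_left sum.distrib v_def w_def mult.left_commute flip: sum_distrib_left)
    ultimately show False using z that by simp
  qed
  define ip where "ip f g = (\<Sum>i<n. m i * f i * g i)" for f g
  have ip_sym: "ip f g = ip g f" for f g unfolding ip_def by (simp add: ac_simps)
  have ip_lin: "ip f (\<lambda>i. s * g i + t * h i) = s * ip f g + t * ip f h" for f g h s t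
    unfolding ip_def by (simp add: sum_distrib_left algebra_simps sum.distrib)
  have ip_lin': "ip (\<lambda>i. s * g i + t * h i) f = s * ip g f + t * ip h f" for f g h s t
    using ip_lin ip_sym by metis
  have ip_cong: "ip f g = ip f h" if "\<And>i. i < n \<Longrightarrow> g i = h i" for f g h
    unfolding ip_def using that by simp
  have ip_pos: "ip f f > 0" if nz: "\<exists>i<n. f i \<noteq> 0" for f
  proof -
    obtain i where "i < n" "f i \<noteq> 0" using nz by auto
    thus ?thesis unfolding ip_def
      by (intro sum_pos2[of _ i])
         (use m in \<open>auto simp: mult.assoc zero_less_mult_iff less_imp_le\<close>)
  qed
  have self_adj: "ip f (L g) = ip (L f) g" for f g
  proof -
    have "ip f (L g) = (\<Sum>i<n. \<Sum>j<n. m i * A $$ (i, j) * (f i * g j))"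
      unfolding ip_def L_def by (simp add: sum_distrib_left algebra_simps)
    also have "\<dots> = (\<Sum>i<n. \<Sum>j<n. m j * A $$ (j, i) * (f i * g j))"
      using rev by (auto intro!: sum.cong)
    also have "\<dots> = (\<Sum>j<n. \<Sum>i<n. m j * A $$ (j, i) * (f i * g j))" by (rule sum.swap)
    also have "\<dots> = ip (L f) g"
      unfolding ip_def L_def by (simp add: sum_distrib_left sum_distrib_right algebra_simps)
    finally show ?thesis .
  qed
  have vv: "ip v v > 0" using indep[of 1 0] by (intro ip_pos) simp
  \<comment> \<open>Gram-Schmidt: \<open>w'\<close> is the part of \<open>w\<close> orthogonal to \<open>v\<close>.\<close>
  define d where "d = ip v w / ip v v"
  define w' where "w' = (\<lambda>i. 1 * w i + (- d) * v i)"
  have w'_nz: "\<exists>i<n. s * v i + t * w' i \<noteq> 0" if "s \<noteq> 0 \<or> t \<noteq> 0" for s t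
  proof -
    have "s * v i + t * w' i = (s - t * d) * v i + t * w i" for i
      by (simp add: w'_def algebra_simps)
    moreover have "s - t * d \<noteq> 0 \<or> t \<noteq> 0" using that by (cases "t = 0") auto
    ultimately show ?thesis using indep[of "s - t * d" t] by (simp only:)
  qed
  have vw': "ip v w' = 0" using vv unfolding w'_def ip_lin by (simp add: d_def)
  have L_lin: "L (\<lambda>i. s * g i + t * h i) i = s * L g i + t * L h i" for g h s t i
    unfolding L_def by (simp add: sum_distrib_left algebra_simps sum.distrib)
  define e where "e = b + d * es ! 1 - d * es ! 0"
  have Lw'0: "L w' i = e * v i + es ! 1 * w' i" if "i < n" for i
    unfolding w'_def L_lin using Lv[OF that] Lw[OF that] by (simp add: e_def algebra_simps)
  \<comment> \<open>Self-adjointness kills the off-diagonal entry \<open>e\<close> in the basis \<open>v\<close>, \<open>w'\<close>.\<close>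
  have "e * ip v v = ip v (L w')"
    using ip_cong[of "L w'" "\<lambda>i. e * v i + es ! 1 * w' i" v] Lw'0 by (simp add: ip_lin vw')
  also have "\<dots> = ip w' (L v)" by (simp only: self_adj[of v w'] ip_sym[of "L v" w'])
  also have "\<dots> = ip w' (\<lambda>i. es ! 0 * v i + 0 * v i)" by (rule ip_cong) (simp add: Lv)
  also have "\<dots> = 0" unfolding ip_lin using vw' ip_sym[of w' v] by simp
  finally have "e = 0" using vv by simp
  hence Lw': "L w' i = es ! 1 * w' i" if "i < n" for i using Lw'0 that by simp
  define U where "U f = (\<Sum>i<n. u i * f i)" for f
  \<comment> \<open>The span of \<open>v\<close> and \<open>w'\<close> is a plane, so it meets the hyperplane in a nonzero vector.\<close>
  obtain s t where st: "s \<noteq> 0 \<or> t \<noteq> 0" "s * U v + t * U w' = 0"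
  proof (cases "U v = 0 \<and> U w' = 0")
    case True thus ?thesis using that[of 1 0] by simp
  next
    case False thus ?thesis using that[of "U w'" "- U v"] by auto
  qed
  define f where "f = (\<lambda>i. s * v i + t * w' i)"
  have "U f = s * U v + t * U w'"
    unfolding U_def f_def by (simp add: sum_distrib_left algebra_simps sum.distrib)
  hence Uf: "(\<Sum>i<n. u i * f i) = 0" using st(2) by (simp add: U_def)
  have ff: "ip f f = s\<^sup>2 * ip v v + t\<^sup>2 * ip w' w'"
    unfolding f_def ip_lin ip_lin' using vw' ip_sym[of w' v] by (simp add: power2_eq_square)
  have "ip f (L f) = ip f (\<lambda>i. (s * es ! 0) * v i + (t * es ! 1) * w' i)"
    by (rule ip_cong) (simp add: f_def L_lin Lv Lw')
  also have "\<dots> = es ! 0 * (s\<^sup>2 * ip v v) + es ! 1 * (t\<^sup>2 * ip w' w')"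
    unfolding f_def ip_lin ip_lin' using vw' ip_sym[of w' v] by (simp add: power2_eq_square)
  finally have fLf: "ip f (L f) = es ! 0 * (s\<^sup>2 * ip v v) + es ! 1 * (t\<^sup>2 * ip w' w')" .
  have "sorted_wrt (\<ge>) es" unfolding es_def eigenvalues_desc_def
    by (simp add: sorted_wrt_rev)
  hence "es ! 0 \<ge> es ! 1" using sorted_wrt_nth_less[of "(\<ge>)" es 0 1] split(2) n by auto
  hence "es ! 1 * ip f f \<le> ip f (L f)"
    unfolding ff fLf using vv by (simp add: distrib_left mult_right_mono)
  also have "\<dots> \<le> c * ip f f"
    using quad[OF Uf] unfolding ip_def L_def by (simp add: power2_eq_square ac_simps)
  finally show ?thesis
    using ip_pos[of f] w'_nz[OF st(1)] unfolding f_def es_def by auto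
qed

section \<open>Chain weights\<close>

definition bond :: "real \<Rightarrow> 'c \<Rightarrow> 'c \<Rightarrow> real" where
  "bond r a b = (if a = b then 1 else r)"

fun chain_weight :: "real \<Rightarrow> 'c list \<Rightarrow> real" where
  "chain_weight r (a # b # s) = bond r a b * chain_weight r (b # s)"
| "chain_weight r _ = 1"

text \<open>
  The factor by which a disagreeing bond is less likely than an agreeing one:
  \<open>exp (- 1 / T)\<close> divided by \<open>exp (1 / T)\<close>.
\<close>

definition bond_ratio :: "real \<Rightarrow> real" where
  "bond_ratio T = exp (- 2 / T)"

lemma bond_commute: "bond r a b = bond r b a"
  by (simp add: bond_def)

text \<open>
  Pulling \<open>exp (1 / T)\<close> out of each of the \<open>n - 1\<close> bonds makes the weight of an agreeing bond \<open>1\<close>. The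
  common factor cancels in all conditional probabilities.
\<close>

lemma ising_weight_eq_chain_weight:
  "ising_weight (length x) T x = exp (1 / T) ^ (length x - 1) * chain_weight (bond_ratio T) x"
proof (induction "bond_ratio T" x rule: chain_weight.induct)
  case (1 a b s)
  have "exp (1 / T) * bond (bond_ratio T) a b = exp (1 / T * (of_bool (a = b) - of_bool (a \<noteq> b)))"
    by (simp add: bond_ratio_def bond_def flip: exp_add)
  thus ?case using 1
    by (simp add: ising_weight_def sum.lessThan_Suc_shift distrib_left exp_add del: sum.lessThan_Suc)
qed (simp_all add: ising_weight_def)

text \<open>
  The Markov property: given the color at one site, the weight factorizes into a left and a right part.
\<close>

lemma chain_weight_append:
  "chain_weight r (p @ a # s) = chain_weight r (p @ [a]) * chain_weight r (a # s)"
  by (induction r p rule: chain_weight.induct) (auto simp: neq_Nil_conv)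

lemma finite_configs [simp]: "finite (configs C n)"
  using set_config_list[of C n] by (metis List.finite_set)

lemma configs_Suc: "configs C (Suc k) = (\<lambda>(a, s). a # s) ` (set C \<times> configs C k)"
  by (auto simp: configs_def length_Suc_conv image_iff)

lemma sum_configs_0 [simp]: "(\<Sum>x\<in>configs C 0. g x) = g []"
proof -
  have "configs C 0 = {[]}" by (auto simp: configs_def)
  thus ?thesis by simp
qed

lemma sum_configs_Suc:
  "(\<Sum>x\<in>configs C (Suc k). g x) = (\<Sum>a\<in>set C. \<Sum>s\<in>configs C k. g (a # s))"
proof -
  have "inj_on (\<lambda>(a, s). a # s) (set C \<times> configs C k)" by (auto simp: inj_on_def)
  thus ?thesis unfolding configs_Suc
    by (simp add: sum.reindex sum.cartesian_product case_prod_unfold)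
qed

lemma sum_configs_add:
  "(\<Sum>x\<in>configs C (k + m). g x) = (\<Sum>p\<in>configs C k. \<Sum>s\<in>configs C m. g (p @ s))"
  by (induction k arbitrary: g) (simp_all add: sum_configs_Suc)

lemma sum_configs_split:
  assumes "k < n"
  shows "(\<Sum>x\<in>configs C n. g x) =
    (\<Sum>p\<in>configs C k. \<Sum>a\<in>set C. \<Sum>s\<in>configs C (n - 1 - k). g (p @ a # s))"
proof -
  have n: "n = k + Suc (n - 1 - k)" using assms by simp
  show ?thesis by (subst n) (simp only: sum_configs_add sum_configs_Suc)
qed

section \<open>Canonical paths and the Poincare inequality\<close>

locale color_chain =
  fixes C :: "'c list" and r :: real
  assumes dist: "distinct C" and C_ne: "C \<noteq> []" and r_pos: "r > 0" and r_le1: "r \<le> 1"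
begin

abbreviation wt :: "'c list \<Rightarrow> real" where "wt \<equiv> chain_weight r"

abbreviation q :: real where "q \<equiv> real (length C)"

text \<open>
  The total weight of the bonds from one color to all colors; dividing by it turns \<^const>\<open>bond\<close> into
  a stochastic matrix.
\<close>

definition W :: real where "W = 1 + (q - 1) * r"

text \<open>
  A bound for the load of the canonical paths on an edge at site \<open>k\<close>, in units of the probability flow
  of the sampler through that edge and up to the factor \<open>n / q\<close>. It is the ratio of the total weight
  of all colorings of the site, between agreeing neighbours, to the smallest product of bond weights.
  The leftmost site has at most one neighbour, so its value is smaller when \<open>r < 1\<close>.
\<close>

definition congestion :: "nat \<Rightarrow> real" where
  "congestion k = (if k = 0 then (1 + (q - 1) * r) / r else (1 + (q - 1) * r\<^sup>2) / r\<^sup>2)"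

text \<open>
  The total weight of the configurations that agree with \<open>p\<close> and \<open>s\<close> around one site: the
  normalizing constant of the conditional distribution at that site.
\<close>

definition fibre_weight :: "'c list \<Rightarrow> 'c list \<Rightarrow> real" where
  "fibre_weight p s = (\<Sum>c\<in>set C. wt (p @ c # s))"

text \<open>
  The contribution of the updates of site \<open>k\<close> to the Dirichlet form, with the factor \<open>1 / (2 n)\<close>
  left out.
\<close>

definition site_energy :: "nat \<Rightarrow> ('c list \<Rightarrow> real) \<Rightarrow> nat \<Rightarrow> real" where
  "site_energy n f k = (\<Sum>p\<in>configs C k. \<Sum>s\<in>configs C (n - 1 - k). \<Sum>a\<in>set C. \<Sum>c\<in>set C.
     wt (p @ a # s) * wt (p @ c # s) / fibre_weight p s * (f (p @ c # s) - f (p @ a # s))\<^sup>2)"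

lemma q_ge1: "q \<ge> 1"
  using C_ne by (cases C) auto

lemma card_C: "real (card (set C)) = q"
  using dist by (simp add: distinct_card)

lemma bond_pos: "bond r a b > 0" and bond_ge: "bond r a b \<ge> r"
  using r_pos r_le1 by (auto simp: bond_def)

lemma wt_pos: "wt x > 0"
  by (induction x rule: induct_list012) (simp_all add: bond_pos)

lemma W_pos: "W > 0"
  using q_ge1 r_pos unfolding W_def by (simp add: add_pos_nonneg)

lemma congestion_pos: "congestion k > 0"
  using q_ge1 r_pos by (auto simp: congestion_def intro!: divide_pos_pos add_pos_nonneg)

lemma fibre_weight_pos: "fibre_weight p s > 0"
  unfolding fibre_weight_def using C_ne wt_pos by (intro sum_pos) auto

lemma sum_if_color:
  assumes "l \<in> set C"
  shows "(\<Sum>c\<in>set C. if l = c then u else v) = u + (q - 1) * (v::real)"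
proof -
  have "(\<Sum>c\<in>set C - {l}. if l = c then u else v) = (\<Sum>c\<in>set C - {l}. v)"
    by (intro sum.cong) auto
  moreover have "real (card (set C - {l})) = q - 1"
    using assms dist q_ge1 by (simp add: distinct_card of_nat_diff)
  ultimately show ?thesis using assms by (simp add: sum.remove[of "set C" l])
qed

lemma sum_bond: "l \<in> set C \<Longrightarrow> (\<Sum>c\<in>set C. bond r l c) = W"
  unfolding bond_def W_def by (rule sum_if_color)

lemma sum_bond_square: "l \<in> set C \<Longrightarrow> (\<Sum>c\<in>set C. (bond r l c)\<^sup>2) = 1 + (q - 1) * r\<^sup>2"
proof -
  assume l: "l \<in> set C"
  have "(bond r l c)\<^sup>2 = (if l = c then 1 else r\<^sup>2)" for c by (simp add: bond_def)
  thus ?thesis using sum_if_color[OF l] by simp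
qed

text \<open>
  Summing out one half of a chain: by the symmetry between the colors the result does not depend on the
  color \<open>a\<close> at the cut. This is what makes the canonical paths computable, since the
  halves of \<open>x\<close> and \<open>y\<close> invisible on an edge contribute only constants.
\<close>

lemma sum_wt_right:
  "a \<in> set C \<Longrightarrow> (\<Sum>s\<in>configs C k. wt (a # s)) = W ^ k"
proof (induction k arbitrary: a)
  case (Suc k)
  have "(\<Sum>s\<in>configs C (Suc k). wt (a # s)) =
      (\<Sum>b\<in>set C. bond r a b * (\<Sum>s\<in>configs C k. wt (b # s)))"
    by (simp add: sum_configs_Suc sum_distrib_left)
  also have "\<dots> = W ^ Suc k"
    using Suc by (simp add: sum_bond flip: sum_distrib_right)
  finally show ?case .
qed simp

lemma sum_wt_left:
  "a \<in> set C \<Longrightarrow> (\<Sum>p\<in>configs C k. wt (p @ [a])) = W ^ k"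
proof (induction k)
  case (Suc k)
  have "wt (b # p @ [a]) = bond r (hd (p @ [a])) b * wt (p @ [a])" for b p
    by (cases p) (simp_all add: bond_commute)
  hence "(\<Sum>p\<in>configs C (Suc k). wt (p @ [a])) =
      (\<Sum>p\<in>configs C k. (\<Sum>b\<in>set C. bond r (hd (p @ [a])) b) * wt (p @ [a]))"
    by (simp add: sum_configs_Suc sum_distrib_right) (rule sum.swap)
  also have "\<dots> = (\<Sum>p\<in>configs C k. W * wt (p @ [a]))"
  proof (intro sum.cong refl)
    fix p assume "p \<in> configs C k"
    hence "hd (p @ [a]) \<in> set C" using Suc.prems by (cases p) (auto simp: configs_def)
    thus "(\<Sum>b\<in>set C. bond r (hd (p @ [a])) b) * wt (p @ [a]) = W * wt (p @ [a])"
      by (simp add: sum_bond)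
  qed
  also have "\<dots> = W ^ Suc k" using Suc by (simp flip: sum_distrib_left)
  finally show ?case .
qed simp

lemma sum_wt: "(\<Sum>x\<in>configs C (Suc k). wt x) = q * W ^ k"
  by (simp add: sum_configs_Suc sum_wt_right card_C)

text \<open>
  An end site has a single bond. The right-hand side is \<^const>\<open>congestion\<close> at an inner site times the
  smallest weight of that bond, so the inner value also serves for the rightmost site.
\<close>

lemma end_bond_bound: "1 + (q - 1) * r \<le> (1 + (q - 1) * r\<^sup>2) / r"
proof -
  have "r * 1 \<le> 1 * (1::real)" using r_le1 by simp
  thus ?thesis using r_pos by (simp add: field_simps power2_eq_square)
qed

text \<open>
  A case distinction on which neighbours the site has. With neighbours \<open>l\<close> and \<open>b\<close> on both sides the
  sum is largest when they agree: by the inequality \<open>2 u v \<le> u\<^sup>2 + v\<^sup>2\<close> each term is at most the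
  average of the terms for the pairs \<open>l, l\<close> and \<open>b, b\<close>, whose sums are both \<open>1 + (q - 1) r\<^sup>2\<close>. On the
  right, every bond weighs at least \<open>r\<close>.
\<close>

lemma fibre_sum_bound:
  assumes p: "p \<in> configs C k" and s: "s \<in> configs C m"
  shows "(\<Sum>c\<in>set C. wt (p @ [c]) * wt (c # s)) \<le> congestion k * (wt (p @ [a]) * wt (a' # s))"
proof -
  have q0: "(q - 1) * r \<ge> 0" "(q - 1) * r\<^sup>2 \<ge> 0" using q_ge1 r_pos by simp_all
  consider "p = []" "s = []" | b t where "p = []" "s = b # t"
    | l p' where "p = p' @ [l]" "s = []" | l p' b t where "p = p' @ [l]" "s = b # t"
    by (metis neq_Nil_conv rev_exhaust)
  thus ?thesis
  proof cases
    case 1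
    hence "k = 0" using p by (simp add: configs_def)
    moreover have "q * r \<le> 1 + (q - 1) * r" using r_le1 by (simp add: algebra_simps)
    ultimately show ?thesis using 1 r_pos by (simp add: card_C congestion_def pos_le_divide_eq)
  next
    case 2
    hence k: "k = 0" and b: "b \<in> set C" using p s by (auto simp: configs_def)
    have "(\<Sum>c\<in>set C. wt (p @ [c]) * wt (c # s)) = (1 + (q - 1) * r) * wt (b # t)"
      using b 2 sum_bond[OF b] by (simp add: bond_commute[of r _ b] W_def flip: sum_distrib_right)
    also have "\<dots> \<le> ((1 + (q - 1) * r) / r * bond r a' b) * wt (b # t)"
    proof (rule mult_right_mono)
      have "(1 + (q - 1) * r) * r \<le> (1 + (q - 1) * r) * bond r a' b"
        using bond_ge q0 by (intro mult_left_mono) auto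
      thus "1 + (q - 1) * r \<le> (1 + (q - 1) * r) / r * bond r a' b"
        using r_pos by (simp add: pos_le_divide_eq)
    qed (use wt_pos in \<open>simp add: less_imp_le\<close>)
    finally show ?thesis using k 2 by (simp add: congestion_def)
  next
    case 3
    hence k: "k \<noteq> 0" and l: "l \<in> set C" using p by (auto simp: configs_def)
    have wp: "wt (p @ [c]) = wt (p' @ [l]) * bond r l c" for c
      using chain_weight_append[of r p' l "[c]"] 3 by simp
    have "(\<Sum>c\<in>set C. wt (p @ [c]) * wt (c # s)) = wt (p' @ [l]) * (1 + (q - 1) * r)"
      unfolding wp using sum_bond[OF l] 3(2) by (simp add: W_def flip: sum_distrib_left)
    also have "\<dots> \<le> wt (p' @ [l]) * ((1 + (q - 1) * r\<^sup>2) / r\<^sup>2 * bond r l a)"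
    proof (rule mult_left_mono)
      note end_bond_bound
      also have "(1 + (q - 1) * r\<^sup>2) / r = (1 + (q - 1) * r\<^sup>2) / r\<^sup>2 * r"
        using r_pos by (simp add: power2_eq_square)
      also have "\<dots> \<le> (1 + (q - 1) * r\<^sup>2) / r\<^sup>2 * bond r l a"
        using bond_ge q0 by (intro mult_left_mono) auto
      finally show "1 + (q - 1) * r \<le> (1 + (q - 1) * r\<^sup>2) / r\<^sup>2 * bond r l a" .
    qed (use wt_pos in \<open>simp add: less_imp_le\<close>)
    finally show ?thesis unfolding wp using k 3(2) by (simp add: congestion_def mult_ac)
  next
    case 4
    hence k: "k \<noteq> 0" and l: "l \<in> set C" and b: "b \<in> set C" using p s by (auto simp: configs_def)
    have wp: "wt (p @ [c]) = wt (p' @ [l]) * bond r l c" for c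
      using chain_weight_append[of r p' l "[c]"] 4 by simp
    have ws: "wt (c # s) = bond r b c * wt (b # t)" for c
      using 4 by (simp add: bond_commute)
    have "(\<Sum>c\<in>set C. bond r l c * bond r b c) \<le> (\<Sum>c\<in>set C. ((bond r l c)\<^sup>2 + (bond r b c)\<^sup>2) / 2)"
      using sum_squares_bound[of "bond r l c" "bond r b c" for c]
      by (intro sum_mono) (simp add: field_simps)
    also have "\<dots> = 1 + (q - 1) * r\<^sup>2"
      using sum_bond_square[OF l] sum_bond_square[OF b] by (simp add: sum.distrib flip: sum_divide_distrib)
    also have "\<dots> = (1 + (q - 1) * r\<^sup>2) / r\<^sup>2 * (r * r)"
      using r_pos by (simp add: power2_eq_square)
    also have "\<dots> \<le> (1 + (q - 1) * r\<^sup>2) / r\<^sup>2 * (bond r l a * bond r b a')"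
      using q0 r_pos
      by (intro mult_left_mono mult_mono bond_ge less_imp_le[OF bond_pos]) (auto simp: less_imp_le)
    finally have bonds: "(\<Sum>c\<in>set C. bond r l c * bond r b c)
        \<le> (1 + (q - 1) * r\<^sup>2) / r\<^sup>2 * (bond r l a * bond r b a')" .
    have "(\<Sum>c\<in>set C. wt (p @ [c]) * wt (c # s))
        = (wt (p' @ [l]) * wt (b # t)) * (\<Sum>c\<in>set C. bond r l c * bond r b c)"
      unfolding wp ws sum_distrib_left by (simp add: mult_ac)
    also have "\<dots> \<le> (wt (p' @ [l]) * wt (b # t)) *
        ((1 + (q - 1) * r\<^sup>2) / r\<^sup>2 * (bond r l a * bond r b a'))"
      using wt_pos by (intro mult_left_mono bonds) (simp add: less_imp_le)
    finally show ?thesis using k by (simp add: wp ws congestion_def mult_ac)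
  qed
qed

text \<open>
  The load on the edge from \<open>p @ a # s\<close> to \<open>p @ c # s\<close>. A path that uses it goes from a configuration
  ending in \<open>a # s\<close> to one beginning with \<open>p @ [c]\<close>, and the left side is what remains of the weights
  of its end points after the invisible halves are summed out. The right side is
  \<^const>\<open>congestion\<close> times the flow of the sampler through the edge.
\<close>

lemma edge_bound:
  assumes "p \<in> configs C k" "s \<in> configs C m"
  shows "wt (a # s) * wt (p @ [c]) \<le>
    congestion k * (wt (p @ a # s) * wt (p @ c # s) / fibre_weight p s)"
proof -
  have fw: "fibre_weight p s = (\<Sum>c\<in>set C. wt (p @ [c]) * wt (c # s))"
    unfolding fibre_weight_def by (rule sum.cong[OF refl]) (rule chain_weight_append)
  have "wt (a # s) * wt (p @ [c]) * fibre_weight p s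
      \<le> wt (a # s) * wt (p @ [c]) * (congestion k * (wt (p @ [a]) * wt (c # s)))"
    unfolding fw using wt_pos by (intro mult_left_mono fibre_sum_bound[OF assms]) (simp add: less_imp_le)
  also have "\<dots> = congestion k * (wt (p @ a # s) * wt (p @ c # s))"
    by (simp add: chain_weight_append[of r p a s] chain_weight_append[of r p c s])
  finally show ?thesis using fibre_weight_pos[of p s] by (simp add: pos_le_divide_eq)
qed

text \<open>
  The \<open>k\<close>-th step of the path from \<open>x = p @ a # s\<close> to \<open>y = p' @ c # s'\<close> changes \<open>p' @ a # s\<close> into
  \<open>p' @ c # s\<close>. Since \<open>p\<close> and \<open>s'\<close> are not involved in the increment of \<open>f\<close>, they can be summed out,
  which gives \<open>k\<close> and \<open>n - 1 - k\<close> factors \<open>W\<close>.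
\<close>

lemma path_step_bound:
  assumes k: "k < n"
  shows "(\<Sum>x\<in>configs C n. \<Sum>y\<in>configs C n. wt x * wt y *
      (f (take (Suc k) y @ drop (Suc k) x) - f (take k y @ drop k x))\<^sup>2)
    \<le> W ^ (n - 1) * (congestion k * site_energy n f k)"
proof -
  define m where "m = n - 1 - k"
  have km: "k + m = n - 1" using k by (simp add: m_def)
  define D where "D p s a c = (f (p @ c # s) - f (p @ a # s))\<^sup>2" for p s a c
  \<comment> \<open>What is left after summing out \<open>p\<close> and \<open>s'\<close>: \<open>p\<close> now names the left half of \<open>y\<close>.\<close>
  define G where "G a s = (\<Sum>p\<in>configs C k. \<Sum>c\<in>set C. wt (a # s) * wt (p @ [c]) * D p s a c)" for a s
  have "(\<Sum>x\<in>configs C n. \<Sum>y\<in>configs C n. wt x * wt y *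
      (f (take (Suc k) y @ drop (Suc k) x) - f (take k y @ drop k x))\<^sup>2)
    = (\<Sum>p\<in>configs C k. \<Sum>a\<in>set C. \<Sum>s\<in>configs C m.
        \<Sum>p'\<in>configs C k. \<Sum>c\<in>set C. \<Sum>s'\<in>configs C m.
          wt (p @ a # s) * wt (p' @ c # s') * D p' s a c)"
    unfolding sum_configs_split[OF k] m_def[symmetric]
    by (intro sum.cong refl) (auto simp: configs_def D_def)
  also have "\<dots> = (\<Sum>p\<in>configs C k. \<Sum>a\<in>set C. \<Sum>s\<in>configs C m.
        wt (p @ [a]) * (W ^ m * G a s))"
  proof (intro sum.cong refl)
    fix p a s assume "a \<in> set C"
    have "(\<Sum>p'\<in>configs C k. \<Sum>c\<in>set C. \<Sum>s'\<in>configs C m.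
          wt (p @ a # s) * wt (p' @ c # s') * D p' s a c)
      = (\<Sum>p'\<in>configs C k. \<Sum>c\<in>set C. (\<Sum>s'\<in>configs C m. wt (c # s')) *
          (wt (p @ [a]) * (wt (a # s) * wt (p' @ [c]) * D p' s a c)))"
      unfolding sum_distrib_right
    proof (intro sum.cong refl)
      fix p' c s'
      show "wt (p @ a # s) * wt (p' @ c # s') * D p' s a c
          = wt (c # s') * (wt (p @ [a]) * (wt (a # s) * wt (p' @ [c]) * D p' s a c))"
        unfolding chain_weight_append[of r p a s] chain_weight_append[of r p' c s']
        by (simp only: mult_ac)
    qed
    also have "\<dots> = wt (p @ [a]) * (W ^ m * G a s)"
      by (simp add: sum_wt_right G_def sum_distrib_left mult_ac)
    finally show "(\<Sum>p'\<in>configs C k. \<Sum>c\<in>set C. \<Sum>s'\<in>configs C m.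
          wt (p @ a # s) * wt (p' @ c # s') * D p' s a c) = wt (p @ [a]) * (W ^ m * G a s)" .
  qed
  also have "\<dots> = (\<Sum>a\<in>set C. (\<Sum>p\<in>configs C k. wt (p @ [a])) * (\<Sum>s\<in>configs C m. W ^ m * G a s))"
    by (subst sum.swap) (simp add: sum_product)
  also have "\<dots> = W ^ (n - 1) * (\<Sum>a\<in>set C. \<Sum>s\<in>configs C m. G a s)"
  proof -
    have "W ^ (n - 1) = W ^ k * W ^ m" using km by (metis power_add)
    thus ?thesis by (simp only: sum_wt_left sum_distrib_left mult_ac cong: sum.cong)
  qed
  finally have total: "(\<Sum>x\<in>configs C n. \<Sum>y\<in>configs C n. wt x * wt y *
      (f (take (Suc k) y @ drop (Suc k) x) - f (take k y @ drop k x))\<^sup>2)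
    = W ^ (n - 1) * (\<Sum>a\<in>set C. \<Sum>s\<in>configs C m. G a s)" .
  have "(\<Sum>a\<in>set C. \<Sum>s\<in>configs C m. G a s) = (\<Sum>p\<in>configs C k. \<Sum>s\<in>configs C m.
      \<Sum>a\<in>set C. \<Sum>c\<in>set C. wt (a # s) * wt (p @ [c]) * D p s a c)"
  proof -
    have "(\<Sum>a\<in>set C. \<Sum>s\<in>configs C m. G a s) = (\<Sum>s\<in>configs C m. \<Sum>a\<in>set C. G a s)"
      by (rule sum.swap)
    also have "\<dots> = (\<Sum>s\<in>configs C m. \<Sum>p\<in>configs C k. \<Sum>a\<in>set C. \<Sum>c\<in>set C.
        wt (a # s) * wt (p @ [c]) * D p s a c)"
      unfolding G_def by (intro sum.cong refl) (rule sum.swap)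
    finally show ?thesis by (simp only: sum.swap[of _ "configs C k" "configs C m"])
  qed
  also have "\<dots> \<le> (\<Sum>p\<in>configs C k. \<Sum>s\<in>configs C m. \<Sum>a\<in>set C. \<Sum>c\<in>set C.
      congestion k * (wt (p @ a # s) * wt (p @ c # s) / fibre_weight p s) * D p s a c)"
    by (intro sum_mono mult_right_mono edge_bound) (auto simp: D_def)
  also have "\<dots> = congestion k * site_energy n f k"
    unfolding site_energy_def sum_distrib_left m_def[symmetric] D_def by (simp add: mult_ac)
  finally have "(\<Sum>a\<in>set C. \<Sum>s\<in>configs C m. G a s) \<le> congestion k * site_energy n f k" .
  thus ?thesis unfolding total using W_pos by (intro mult_left_mono) auto
qed

text \<open>
  The variance of \<open>f\<close> is half the mean of \<open>(f y - f x)\<^sup>2\<close> over independent \<open>x\<close> and \<open>y\<close>, and the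
  increment is telescoped along the canonical path. In the Cauchy-Schwarz inequality each step is
  weighted by its congestion instead of equally; this turns \<open>n\<close> times the maximal congestion into the
  sum of the congestions, and so lets the smaller value at the first site count.
\<close>

lemma poincare:
  assumes n: "n \<ge> 1" and mean0: "(\<Sum>x\<in>configs C n. wt x * f x) = 0"
  shows "2 * q * (\<Sum>x\<in>configs C n. wt x * (f x)\<^sup>2)
    \<le> (\<Sum>k<n. congestion k) * (\<Sum>k<n. site_energy n f k)"
proof -
  define V where "V = (\<Sum>x\<in>configs C n. wt x * (f x)\<^sup>2)"
  define Z where "Z = (\<Sum>x\<in>configs C n. wt x)"
  define K where "K = (\<Sum>k<n. congestion k)"
  define d where "d x y k = f (take (Suc k) y @ drop (Suc k) x) - f (take k y @ drop k x)" for x y k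
  have K_nonneg: "K \<ge> 0" unfolding K_def using congestion_pos by (simp add: sum_nonneg less_imp_le)
  have Z: "Z = q * W ^ (n - 1)" using sum_wt[of "n - 1"] n by (simp add: Z_def)
  have diff: "(f y - f x)\<^sup>2 \<le> K * (\<Sum>k<n. (d x y k)\<^sup>2 / congestion k)"
    if "x \<in> configs C n" "y \<in> configs C n" for x y
  proof -
    have "f y - f x = (\<Sum>k<n. d x y k)"
      unfolding d_def using that
      by (subst sum_lessThan_telescope) (simp add: configs_def)
    also have "\<dots> = (\<Sum>k<n. sqrt (congestion k) * (d x y k / sqrt (congestion k)))"
      using congestion_pos by (simp add: less_imp_neq[symmetric])
    also have "\<dots>\<^sup>2 \<le> (\<Sum>k<n. (sqrt (congestion k))\<^sup>2) * (\<Sum>k<n. (d x y k / sqrt (congestion k))\<^sup>2)"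
      by (rule Cauchy_Schwarz_ineq_sum)
    also have "\<dots> = K * (\<Sum>k<n. (d x y k)\<^sup>2 / congestion k)"
      using congestion_pos by (simp add: K_def power_divide less_imp_le)
    finally show ?thesis .
  qed
  have "(\<Sum>x\<in>configs C n. \<Sum>y\<in>configs C n. wt x * wt y * (f y - f x)\<^sup>2)
    = (\<Sum>x\<in>configs C n. \<Sum>y\<in>configs C n. wt x * (wt y * (f y)\<^sup>2) + wt x * (f x)\<^sup>2 * wt y
        - 2 * (wt x * f x) * (wt y * f y))"
    by (intro sum.cong refl) (simp add: power2_eq_square algebra_simps)
  also have "\<dots> = Z * V + V * Z - 2 * (\<Sum>x\<in>configs C n. wt x * f x) * (\<Sum>y\<in>configs C n. wt y * f y)"
  proof -
    have "(\<Sum>x\<in>configs C n. \<Sum>y\<in>configs C n. wt x * (wt y * (f y)\<^sup>2)) = Z * V"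
      "(\<Sum>x\<in>configs C n. \<Sum>y\<in>configs C n. wt x * (f x)\<^sup>2 * wt y) = V * Z"
      unfolding Z_def V_def sum_product by (rule refl)+
    moreover have "(\<Sum>x\<in>configs C n. \<Sum>y\<in>configs C n. 2 * (wt x * f x) * (wt y * f y))
        = 2 * (\<Sum>x\<in>configs C n. wt x * f x) * (\<Sum>y\<in>configs C n. wt y * f y)"
      unfolding mult.assoc sum_product by (simp only: sum_distrib_left)
    ultimately show ?thesis by (simp only: sum.distrib sum_subtractf)
  qed
  also have "\<dots> = Z * V + V * Z" using mean0 by simp
  finally have "2 * Z * V = (\<Sum>x\<in>configs C n. \<Sum>y\<in>configs C n. wt x * wt y * (f y - f x)\<^sup>2)"
    by simp
  also have "\<dots> \<le> (\<Sum>x\<in>configs C n. \<Sum>y\<in>configs C n. wt x * wt y *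
      (K * (\<Sum>k<n. (d x y k)\<^sup>2 / congestion k)))"
    using diff wt_pos by (intro sum_mono mult_left_mono) (auto simp: less_imp_le)
  also have "\<dots> = K * (\<Sum>x\<in>configs C n. \<Sum>y\<in>configs C n. \<Sum>k<n.
      (wt x * wt y * (d x y k)\<^sup>2) / congestion k)"
    by (simp add: sum_distrib_left mult_ac)
  also have "(\<Sum>x\<in>configs C n. \<Sum>y\<in>configs C n. \<Sum>k<n. (wt x * wt y * (d x y k)\<^sup>2) / congestion k)
    = (\<Sum>k<n. (\<Sum>x\<in>configs C n. \<Sum>y\<in>configs C n. wt x * wt y * (d x y k)\<^sup>2) / congestion k)"
  proof -
    have "(\<Sum>x\<in>configs C n. \<Sum>y\<in>configs C n. \<Sum>k<n. (wt x * wt y * (d x y k)\<^sup>2) / congestion k)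
      = (\<Sum>x\<in>configs C n. \<Sum>k<n. \<Sum>y\<in>configs C n. (wt x * wt y * (d x y k)\<^sup>2) / congestion k)"
      by (intro sum.cong refl) (rule sum.swap)
    also have "\<dots> = (\<Sum>k<n. \<Sum>x\<in>configs C n. \<Sum>y\<in>configs C n. (wt x * wt y * (d x y k)\<^sup>2) / congestion k)"
      by (rule sum.swap)
    finally show ?thesis by (simp add: sum_divide_distrib)
  qed
  also have "K * \<dots> \<le> K * (\<Sum>k<n. W ^ (n - 1) * site_energy n f k)"
  proof (intro mult_left_mono sum_mono K_nonneg)
    fix k assume "k \<in> {..<n}"
    thus "(\<Sum>x\<in>configs C n. \<Sum>y\<in>configs C n. wt x * wt y * (d x y k)\<^sup>2) / congestion k
        \<le> W ^ (n - 1) * site_energy n f k"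
      using path_step_bound[of k n f] congestion_pos[of k]
      by (simp add: d_def pos_divide_le_eq mult_ac)
  qed
  also have "\<dots> = W ^ (n - 1) * (K * (\<Sum>k<n. site_energy n f k))"
    by (simp add: sum_distrib_left mult_ac)
  finally have "W ^ (n - 1) * (2 * q * V) \<le> W ^ (n - 1) * (K * (\<Sum>k<n. site_energy n f k))"
    by (simp add: Z mult_ac)
  thus ?thesis using W_pos by (simp add: V_def K_def)
qed

definition cond :: "nat \<Rightarrow> 'c \<Rightarrow> 'c list \<Rightarrow> real" where
  "cond i c x = wt (x[i := c]) / (\<Sum>l\<in>set C. wt (x[i := l]))"

lemma cond_split: "cond (length p) c (p @ a # s) = wt (p @ c # s) / fibre_weight p s"
  by (simp add: cond_def fibre_weight_def)

text \<open>
  The Gibbs sampler as an operator on functions. The sum may run over all colors, including the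
  current one, since that term vanishes.
\<close>

definition gibbs_op :: "nat \<Rightarrow> ('c list \<Rightarrow> real) \<Rightarrow> 'c list \<Rightarrow> real" where
  "gibbs_op n f x = f x + 1 / real n * (\<Sum>i<n. \<Sum>c\<in>set C. cond i c x * (f (x[i := c]) - f x))"

text \<open>
  Within a fibre of configurations that differ only at site \<open>k\<close> the update is a fresh draw, so its
  kernel is symmetric in the old and new colors \<open>a\<close> and \<open>c\<close> after multiplication with the weight.
  Averaging with the roles of \<open>a\<close> and \<open>c\<close> exchanged turns \<open>f a (f a - f c)\<close> into half the square of \<open>f c - f a\<close>.
\<close>

lemma dirichlet_form:
  assumes n: "n \<ge> 1"
  shows "(\<Sum>x\<in>configs C n. wt x * f x * (f x - gibbs_op n f x))
    = 1 / (2 * real n) * (\<Sum>k<n. site_energy n f k)"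
proof -
  have site: "(\<Sum>x\<in>configs C n. wt x * f x * (\<Sum>c\<in>set C. cond k c x * (f x - f (x[k := c]))))
      = site_energy n f k / 2" if k: "k < n" for k
  proof -
    define m where "m = n - 1 - k"
    have "(\<Sum>x\<in>configs C n. wt x * f x * (\<Sum>c\<in>set C. cond k c x * (f x - f (x[k := c]))))
      = (\<Sum>p\<in>configs C k. \<Sum>a\<in>set C. \<Sum>s\<in>configs C m. \<Sum>c\<in>set C.
          wt (p @ a # s) * wt (p @ c # s) / fibre_weight p s *
            (f (p @ a # s) * (f (p @ a # s) - f (p @ c # s))))"
      unfolding sum_configs_split[OF k] m_def[symmetric] sum_distrib_left
    proof (intro sum.cong refl)
      fix p a s c assume "p \<in> configs C k"
      hence k: "k = length p" by (simp add: configs_def)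
      show "wt (p @ a # s) * f (p @ a # s) *
          (cond k c (p @ a # s) * (f (p @ a # s) - f ((p @ a # s)[k := c]))) =
          wt (p @ a # s) * wt (p @ c # s) / fibre_weight p s *
            (f (p @ a # s) * (f (p @ a # s) - f (p @ c # s)))"
        unfolding k cond_split by simp
    qed
    also have "\<dots> = (\<Sum>p\<in>configs C k. \<Sum>s\<in>configs C m. \<Sum>a\<in>set C. \<Sum>c\<in>set C.
          wt (p @ a # s) * wt (p @ c # s) / fibre_weight p s *
            (f (p @ a # s) * (f (p @ a # s) - f (p @ c # s))))"
      by (intro sum.cong refl sum.swap)
    also have "\<dots> = (\<Sum>p\<in>configs C k. \<Sum>s\<in>configs C m. (\<Sum>a\<in>set C. \<Sum>c\<in>set C.
          wt (p @ a # s) * wt (p @ c # s) / fibre_weight p s * (f (p @ c # s) - f (p @ a # s))\<^sup>2) / 2)"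
    proof (intro sum.cong refl)
      fix p s
      define h where "h a c = wt (p @ a # s) * wt (p @ c # s) / fibre_weight p s" for a c
      define g where "g a = f (p @ a # s)" for a
      have h_sym: "h c a = h a c" for a c by (simp add: h_def mult.commute)
      have "(\<Sum>a\<in>set C. \<Sum>c\<in>set C. h a c * (g c - g a)\<^sup>2)
        = (\<Sum>a\<in>set C. \<Sum>c\<in>set C. h a c * (g a * (g a - g c)) + h c a * (g c * (g c - g a)))"
      proof (intro sum.cong refl)
        fix a c
        show "h a c * (g c - g a)\<^sup>2 = h a c * (g a * (g a - g c)) + h c a * (g c * (g c - g a))"
          unfolding h_sym[of c a] by (simp add: power2_eq_square algebra_simps)
      qed
      also have "\<dots> = (\<Sum>a\<in>set C. \<Sum>c\<in>set C. h a c * (g a * (g a - g c)))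
          + (\<Sum>a\<in>set C. \<Sum>c\<in>set C. h c a * (g c * (g c - g a)))"
        by (simp only: sum.distrib)
      also have "(\<Sum>a\<in>set C. \<Sum>c\<in>set C. h c a * (g c * (g c - g a)))
          = (\<Sum>a\<in>set C. \<Sum>c\<in>set C. h a c * (g a * (g a - g c)))"
        by (rule sum.swap)
      finally show "(\<Sum>a\<in>set C. \<Sum>c\<in>set C. wt (p @ a # s) * wt (p @ c # s) / fibre_weight p s *
            (f (p @ a # s) * (f (p @ a # s) - f (p @ c # s))))
          = (\<Sum>a\<in>set C. \<Sum>c\<in>set C. wt (p @ a # s) * wt (p @ c # s) / fibre_weight p s *
              (f (p @ c # s) - f (p @ a # s))\<^sup>2) / 2"
        unfolding h_def g_def by simp
    qed
    also have "\<dots> = site_energy n f k / 2"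
      unfolding site_energy_def m_def by (simp only: sum_divide_distrib)
    finally show ?thesis .
  qed
  have "wt x * f x * (f x - gibbs_op n f x)
      = 1 / real n * (\<Sum>k<n. wt x * f x * (\<Sum>c\<in>set C. cond k c x * (f x - f (x[k := c]))))" for x
  proof -
    have "f x - gibbs_op n f x = 1 / real n * (\<Sum>k<n. \<Sum>c\<in>set C. cond k c x * (f x - f (x[k := c])))"
      by (simp add: gibbs_op_def right_diff_distrib sum_subtractf diff_divide_distrib)
    thus ?thesis by (simp add: sum_distrib_left mult_ac)
  qed
  hence "(\<Sum>x\<in>configs C n. wt x * f x * (f x - gibbs_op n f x))
      = 1 / real n * (\<Sum>x\<in>configs C n. \<Sum>k<n. wt x * f x * (\<Sum>c\<in>set C. cond k c x * (f x - f (x[k := c]))))"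
    by (simp only: sum_distrib_left)
  also have "\<dots> = 1 / real n * (\<Sum>k<n. site_energy n f k / 2)"
    by (subst sum.swap) (simp add: site)
  finally show ?thesis by (simp add: sum_divide_distrib[symmetric])
qed

lemma spectral_gap_form:
  assumes n: "n \<ge> 1" and mean0: "(\<Sum>x\<in>configs C n. wt x * f x) = 0"
  shows "(\<Sum>x\<in>configs C n. wt x * f x * gibbs_op n f x)
    \<le> (1 - q / (real n * (\<Sum>k<n. congestion k))) * (\<Sum>x\<in>configs C n. wt x * (f x)\<^sup>2)"
proof -
  define V where "V = (\<Sum>x\<in>configs C n. wt x * (f x)\<^sup>2)"
  define E where "E = (\<Sum>x\<in>configs C n. wt x * f x * (f x - gibbs_op n f x))"
  define K where "K = (\<Sum>k<n. congestion k)"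
  have K_pos: "K > 0" unfolding K_def using n congestion_pos by (intro sum_pos) (auto simp: lessThan_empty_iff)
  have "2 * q * V \<le> K * (2 * real n * E)"
    using poincare[OF n mean0] dirichlet_form[OF n, of f] n by (simp add: V_def K_def E_def)
  hence "q / (real n * K) * V \<le> E"
    using n K_pos by (simp add: field_simps)
  moreover have "E = V - (\<Sum>x\<in>configs C n. wt x * f x * gibbs_op n f x)"
    unfolding E_def V_def by (simp add: algebra_simps power2_eq_square sum_subtractf)
  ultimately show ?thesis by (simp add: V_def K_def algebra_simps)
qed

end

section \<open>The Gibbs sampler for the Ising chain\<close>

lemma differ_only_at_iff:
  assumes "length x = n" "length y = n"
  shows "differ_only_at n x y i \<longleftrightarrow> i < n \<and> x ! i \<noteq> y ! i \<and> y = x[i := y ! i]"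
proof -
  have "y = x[i := y ! i] \<longleftrightarrow> (\<forall>j<n. y ! j = (if j = i then y ! i else x ! j))" if "i < n"
    using assms that by (auto simp: list_eq_iff_nth_eq nth_list_update)
  thus ?thesis unfolding differ_only_at_def by (smt (verit))
qed

lemma gibbs_kernel_differ:
  assumes "differ_only_at n x y i"
  shows "gibbs_kernel C n T x y = 1 / real n * ising_cond C n T i (y ! i) x"
proof -
  have "x \<noteq> y" using assms by (auto simp: differ_only_at_def)
  moreover have "(THE i. differ_only_at n x y i) = i"
    using assms by (auto simp: differ_only_at_def intro!: the_equality)
  ultimately show ?thesis using assms by (auto simp: gibbs_kernel_def)
qed

locale ising_chain =
  fixes C :: "'c list" and n :: nat and T :: real
  assumes distinct: "distinct C" and ne: "C \<noteq> []" and n_ge1: "n \<ge> 1" and T_pos: "T > 0"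

sublocale ising_chain \<subseteq> color_chain C "bond_ratio T"
  using distinct ne T_pos by unfold_locales (auto simp: bond_ratio_def)

context ising_chain
begin

lemma ising_cond_eq:
  assumes "x \<in> configs C n"
  shows "ising_cond C n T i c x = cond i c x"
proof -
  define u where "u = 1 / ising_Z C n T * exp (1 / T) ^ (n - 1)"
  have "ising C n T y = u * wt y" if "length y = n" for y
    using ising_weight_eq_chain_weight[of y T] that by (simp add: ising_def u_def)
  hence "ising_cond C n T i c x = (u * wt (x[i := c])) / (u * (\<Sum>l\<in>set C. wt (x[i := l])))"
    using assms by (simp add: ising_cond_def configs_def sum_distrib_left)
  moreover have "ising_Z C n T > 0" unfolding ising_Z_def
  proof (rule sum_pos)
    have "replicate n (hd C) \<in> configs C n" using ne by (auto simp: configs_def set_replicate_conv_if)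
    thus "configs C n \<noteq> {}" by blast
  qed (simp_all add: ising_weight_def)
  hence "u \<noteq> 0" by (simp add: u_def)
  ultimately show ?thesis by (simp add: cond_def)
qed

text \<open>
  Two configurations that differ at one site lie in the same fibre, so their conditional
  probabilities have the same denominator and their numerators are the two weights.
\<close>

lemma kernel_reversible:
  assumes x: "x \<in> configs C n" and y: "y \<in> configs C n"
  shows "wt x * gibbs_kernel C n T x y = wt y * gibbs_kernel C n T y x"
proof (cases "\<exists>i. differ_only_at n x y i")
  case True
  then obtain i where i: "differ_only_at n x y i" by blast
  have i': "differ_only_at n y x i" using i by (auto simp: differ_only_at_def)
  have len: "length x = n" "length y = n" using x y by (auto simp: configs_def)
  have eq: "x[i := y ! i] = y" "y[i := x ! i] = x"
    using i i' differ_only_at_iff len by metis+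
  have "x[i := l] = y[i := l]" for l using eq(1) by (metis list_update_overwrite)
  thus ?thesis
    using gibbs_kernel_differ[OF i] gibbs_kernel_differ[OF i'] eq
    by (simp add: ising_cond_eq x y cond_def)
next
  case False
  moreover have "differ_only_at n y x i \<longleftrightarrow> differ_only_at n x y i" for i
    by (auto simp: differ_only_at_def)
  ultimately show ?thesis by (auto simp: gibbs_kernel_def)
qed

text \<open>
  Row sums of the kernel become sums over moves: the configurations one step away from \<open>x\<close> correspond
  bijectively to the pairs of a site and a new color for it.
\<close>

lemma kernel_sum_eq_gibbs_op:
  assumes x: "x \<in> configs C n"
  shows "(\<Sum>y\<in>configs C n. gibbs_kernel C n T x y * f y) = gibbs_op n f x"
proof -
  have len: "length x = n" using x by (simp add: configs_def)
  \<comment> \<open>The moves that change \<open>x\<close>; moves that keep the current color are part of the diagonal entry.\<close>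
  define S where "S = Sigma {..<n} (\<lambda>i. set C - {x ! i})"
  have upd: "x[i := c] \<in> configs C n" "x[i := c] \<noteq> x" "differ_only_at n x (x[i := c]) i"
    if "(i, c) \<in> S" for i c
  proof -
    have i: "i < n" "c \<in> set C" "c \<noteq> x ! i" using that by (auto simp: S_def)
    show "x[i := c] \<in> configs C n"
      using x i set_update_subset_insert[of x i c] by (auto simp: configs_def)
    have "x[i := c] ! i = c" using i len by simp
    thus "x[i := c] \<noteq> x" using i by metis
    show "differ_only_at n x (x[i := c]) i" using i len by (auto simp: differ_only_at_def)
  qed
  have inj: "inj_on (\<lambda>(i, c). x[i := c]) S"
  proof (rule inj_onI, clarify)
    fix i c j d assume S: "(i, c) \<in> S" "(j, d) \<in> S" and eq: "x[i := c] = x[j := d]"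
    have "i = j" using upd(3)[OF S(1)] upd(3)[OF S(2)] eq by (auto simp: differ_only_at_def)
    moreover have "i < length x" using S len by (simp add: S_def)
    ultimately show "i = j \<and> c = d" using eq by (metis nth_list_update_eq)
  qed
  have zero: "gibbs_kernel C n T x y = 0"
    if "y \<in> configs C n - {x}" "y \<notin> (\<lambda>(i, c). x[i := c]) ` S" for y
  proof -
    have "\<not> differ_only_at n x y i" for i
    proof
      assume d: "differ_only_at n x y i"
      have "length y = n" using that by (simp add: configs_def)
      hence y: "y = x[i := y ! i]" "i < n" "x ! i \<noteq> y ! i"
        using d differ_only_at_iff[OF len] by blast+
      hence "y ! i \<in> set C" using that by (auto simp: configs_def)
      hence "(i, y ! i) \<in> S" using y by (auto simp: S_def)
      thus False using that(2) y(1) by (force simp: image_iff)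
    qed
    thus ?thesis using that by (auto simp: gibbs_kernel_def)
  qed
  have "(\<Sum>y\<in>configs C n - {x}. gibbs_kernel C n T x y * f y)
      = (\<Sum>y\<in>(\<lambda>(i, c). x[i := c]) ` S. gibbs_kernel C n T x y * f y)"
    using upd zero by (intro sum.mono_neutral_right) auto
  also have "\<dots> = (\<Sum>(i, c)\<in>S. 1 / real n * (cond i c x * f (x[i := c])))"
  proof (subst sum.reindex[OF inj], intro sum.cong refl)
    fix z assume "z \<in> S"
    then obtain i c where z: "z = (i, c)" "(i, c) \<in> S" by (cases z) auto
    have "i < length x" using z len by (simp add: S_def)
    thus "((\<lambda>y. gibbs_kernel C n T x y * f y) \<circ> (\<lambda>(i, c). x[i := c])) z =
        (case z of (i, c) \<Rightarrow> 1 / real n * (cond i c x * f (x[i := c])))"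
      using gibbs_kernel_differ[OF upd(3)[OF z(2)], of C T] z
      by (simp add: ising_cond_eq[OF x])
  qed
  also have "\<dots> = 1 / real n * (\<Sum>i<n. \<Sum>c\<in>set C - {x ! i}. cond i c x * f (x[i := c]))"
    unfolding S_def by (subst sum.Sigma[symmetric]) (simp_all add: sum_distrib_left)
  finally have off: "(\<Sum>y\<in>configs C n - {x}. gibbs_kernel C n T x y * f y)
      = 1 / real n * (\<Sum>i<n. \<Sum>c\<in>set C - {x ! i}. cond i c x * f (x[i := c]))" .
  have diag: "gibbs_kernel C n T x x = 1 - 1 / real n * (\<Sum>i<n. \<Sum>c\<in>set C - {x ! i}. cond i c x)"
    by (simp add: gibbs_kernel_def ising_cond_eq[OF x])
  have "(\<Sum>y\<in>configs C n. gibbs_kernel C n T x y * f y)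
      = gibbs_kernel C n T x x * f x + (\<Sum>y\<in>configs C n - {x}. gibbs_kernel C n T x y * f y)"
    by (rule sum.remove[OF finite_configs x])
  also have "\<dots> = f x + 1 / real n *
      (\<Sum>i<n. \<Sum>c\<in>set C - {x ! i}. cond i c x * (f (x[i := c]) - f x))"
    unfolding off diag by (simp add: right_diff_distrib left_diff_distrib sum_subtractf
        diff_divide_distrib flip: sum_distrib_right)
  also have "(\<Sum>i<n. \<Sum>c\<in>set C - {x ! i}. cond i c x * (f (x[i := c]) - f x))
      = (\<Sum>i<n. \<Sum>c\<in>set C. cond i c x * (f (x[i := c]) - f x))"
    by (intro sum.cong refl sum.mono_neutral_left) auto
  finally show ?thesis by (simp add: gibbs_op_def)
qed

text \<open>
  The bound for any number of colors, with the sum of the site-dependent congestions. At least two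
  colors are needed for the matrix to have a second eigenvalue at all.
\<close>

theorem gibbs_beta_1_le:
  assumes "length C \<ge> 2"
  shows "gibbs_beta C n T 1 \<le> 1 - q / (real n * (\<Sum>k<n. congestion k))"
proof -
  define xs where "xs = config_list C n"
  define N where "N = length xs"
  have set_xs: "set xs = configs C n" and dist_xs: "distinct xs"
    using distinct by (simp_all add: xs_def set_config_list distinct_config_list)
  have bij: "bij_betw ((!) xs) {..<N} (configs C n)"
    using bij_betw_nth[OF dist_xs] set_xs by (simp add: N_def)
  have sum_xs: "(\<Sum>i<N. h (xs ! i)) = (\<Sum>x\<in>configs C n. h x)" for h :: "'c list \<Rightarrow> real"
    by (rule sum.reindex_bij_betw[OF bij])
  have mem: "xs ! i \<in> configs C n" if "i < N" for i
    using that set_xs by (metis N_def nth_mem)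
  have "length C ^ 1 \<le> length C ^ n" using assms n_ge1 by (intro power_increasing) auto
  hence N: "N \<ge> 2" using assms by (simp add: N_def xs_def length_config_list)
  have A: "gibbs_matrix C n T \<in> carrier_mat N N"
    by (simp add: gibbs_matrix_def N_def xs_def Let_def)
  have entry: "gibbs_matrix C n T $$ (i, j) = gibbs_kernel C n T (xs ! i) (xs ! j)"
    if "i < N" "j < N" for i j
    using that by (simp add: gibbs_matrix_def N_def xs_def Let_def)
  show ?thesis unfolding gibbs_beta_def
  proof (rule second_eigenvalue_le[OF A N])
    fix g :: "nat \<Rightarrow> real"
    assume mean0: "(\<Sum>i<N. wt (xs ! i) * g i) = 0"
    define f where "f x = g (the_inv_into {..<N} ((!) xs) x)" for x
    have f: "f (xs ! i) = g i" if "i < N" for i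
      using that bij the_inv_into_f_f[of "(!) xs" "{..<N}" i] by (simp add: f_def bij_betw_def)
    have "(\<Sum>x\<in>configs C n. wt x * f x) = 0"
      using mean0 by (simp add: f flip: sum_xs)
    note spectral_gap_form[OF n_ge1 this]
    also have "(\<Sum>x\<in>configs C n. wt x * (f x)\<^sup>2) = (\<Sum>i<N. wt (xs ! i) * (g i)\<^sup>2)"
      by (simp add: f flip: sum_xs)
    also have "(\<Sum>x\<in>configs C n. wt x * f x * gibbs_op n f x)
        = (\<Sum>i<N. wt (xs ! i) * g i * (\<Sum>j<N. gibbs_matrix C n T $$ (i, j) * g j))"
      unfolding sum_xs[symmetric]
    proof (intro sum.cong refl)
      fix i assume "i \<in> {..<N}"
      hence i: "i < N" by simp
      have "gibbs_op n f (xs ! i) = (\<Sum>j<N. gibbs_kernel C n T (xs ! i) (xs ! j) * f (xs ! j))"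
        unfolding kernel_sum_eq_gibbs_op[OF mem[OF i], symmetric] by (rule sum_xs[symmetric])
      also have "\<dots> = (\<Sum>j<N. gibbs_matrix C n T $$ (i, j) * g j)"
        by (intro sum.cong refl) (simp add: entry i f)
      finally show "wt (xs ! i) * f (xs ! i) * gibbs_op n f (xs ! i)
          = wt (xs ! i) * g i * (\<Sum>j<N. gibbs_matrix C n T $$ (i, j) * g j)"
        by (simp add: f i)
    qed
    finally show "(\<Sum>i<N. wt (xs ! i) * g i * (\<Sum>j<N. gibbs_matrix C n T $$ (i, j) * g j))
        \<le> (1 - q / (real n * (\<Sum>k<n. congestion k))) * (\<Sum>i<N. wt (xs ! i) * (g i)\<^sup>2)" .
  qed (simp_all add: wt_pos entry kernel_reversible mem)
qed

end

text \<open>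
  For three colors the congestion is \<open>K = (1 + 2 r\<^sup>2) / r\<^sup>2\<close> with \<open>r\<^sup>2 = exp (- 4 / T)\<close> at all sites but
  the first, where it is smaller because \<open>r < 1\<close>. This single site makes the inequality strict,
  also when \<open>n = 1\<close>.
\<close>

theorem theorem2:
  fixes c1 c2 c3 :: 'c and n :: nat and T :: real
  assumes "distinct [c1, c2, c3]"
    and "n \<ge> 1"
    and "T > 0"
  shows "gibbs_beta [c1, c2, c3] n T 1
           < 1 - 3 / (real n)\<^sup>2 * (exp (- 4 / T) / (1 + 2 * exp (- 4 / T)))"
proof -
  interpret ising_chain "[c1, c2, c3]" n T
    using assms by unfold_locales auto
  define r where "r = bond_ratio T"
  have r: "0 < r" "r < 1" using assms(3) by (simp_all add: r_def bond_ratio_def)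
  have r2: "exp (- 4 / T) = r\<^sup>2" by (simp add: r_def bond_ratio_def power2_eq_square flip: exp_add)
  define K where "K = (1 + 2 * r\<^sup>2) / r\<^sup>2"
  have first: "congestion 0 < K"
  proof -
    have "r * (1 + 2 * r) < 1 + 2 * r\<^sup>2" using r by (simp add: power2_eq_square algebra_simps)
    hence "r * (1 + 2 * r) / r\<^sup>2 < K" unfolding K_def using r by (intro divide_strict_right_mono) auto
    thus ?thesis
      unfolding congestion_def unfolding r_def[symmetric] using r by (simp add: power2_eq_square)
  qed
  have rest: "congestion k = K" if "k > 0" for k
    using that unfolding congestion_def unfolding r_def[symmetric] by (simp add: K_def)
  have K_pos: "K > 0" using first congestion_pos[of 0] by simp
  have pos: "(\<Sum>k<n. congestion k) > 0" using assms(2) congestion_pos by (intro sum_pos) (auto simp: lessThan_empty_iff)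
  have "(\<Sum>k<n. congestion k) < (\<Sum>k<n. K)"
  proof (rule sum_strict_mono_ex1)
    show "\<forall>k\<in>{..<n}. congestion k \<le> K" using first rest by (metis less_eq_real_def neq0_conv)
    show "\<exists>k\<in>{..<n}. congestion k < K" using first assms(2) by (intro bexI[of _ 0]) auto
  qed simp
  hence "3 / (real n * (real n * K)) < 3 / (real n * (\<Sum>k<n. congestion k))"
    using pos K_pos assms(2) by (intro divide_strict_left_mono mult_strict_left_mono mult_pos_pos) auto
  moreover have "3 / (real n * (real n * K)) = 3 / (real n)\<^sup>2 * (r\<^sup>2 / (1 + 2 * r\<^sup>2))"
    by (simp add: K_def power2_eq_square)
  moreover have "gibbs_beta [c1, c2, c3] n T 1 \<le> 1 - 3 / (real n * (\<Sum>k<n. congestion k))"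
    using gibbs_beta_1_le by simp
  ultimately show ?thesis unfolding r2 by linarith
qed

end
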